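(* Let $\mathcal{V}$ be a scalar product space of finite dimension $d$ over a field $\mathcal{F}$, with scalar product $g$. Let $r,s\in\bigwedge^p\mathcal{V}$, let $\{x_1,\ldots,x_d\}$ be the basis for $\mathcal{V}$ used in defining the Hodge star $\ast$, and let $G=\det[g(x_i,x_j)]$. Then $$g(r,s)=G\,g(\ast r,\ast s).$$
   Context: A scalar product on $\mathcal{V}$ is a symmetric nondegenerate bilinear functional $g:\mathcal{V}\times\mathcal{V}\to\mathcal{F}$ (no definiteness assumed); a vector space with a designated scalar product is a scalar product space. The scalar product is extended to each exterior power $\bigwedge^p\mathcal{V}$ as the unique bilinear functional, also denoted $g$, with $g(v_1\wedge\cdots\wedge v_p,w_1\wedge\cdots\wedge w_p)=\det[g(v_i,w_j)]$ (and $g(a\cdot 1,b\cdot 1)=ab$ for $p=0$). Given a basis $\{x_1,\ldots,x_d\}$ of $\mathcal{V}$, the reciprocal basis $\{x_1^{\bot},\ldots,x_d^{\bot}\}$ is the basis of $\mathcal{V}$ determined by $g(x_i^{\bot},x_j)=\delta_{i,j}$. The Hodge star $\ast:\bigwedge\mathcal{V}\to\bigwedge\mathcal{V}$ defined using the basis $\{x_1,\ldots,x_d\}$ is the linear map such that $$\ast(x_{i_1}\wedge\cdots\wedge x_{i_n})=(-1)^{\rho}\cdot x_{i_{n+1}}^{\bot}\wedge\cdots\wedge x_{i_d}^{\bot}$$ for every $n$ and every permutation $\rho=(i_1,\ldots,i_d)$ of $(1,\ldots,d)$, where $(-1)^{\rho}$ is the sign of $\rho$ and empty products equal $1$. *)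

theory Defs
  imports
    "Jordan_Normal_Form.Determinant"
    "HOL-Combinatorics.Permutations"
    "HOL-Library.Poly_Mapping"
begin

section \<open>Scalar product spaces\<close>

text \<open>A vector space is given by its scalar multiplication on a type \<open>'v\<close>; the space is the
  whole type.\<close>

definition scalar_product ::
  "('f::field \<Rightarrow> 'v::ab_group_add \<Rightarrow> 'v) \<Rightarrow> ('v \<Rightarrow> 'v \<Rightarrow> 'f) \<Rightarrow> bool" where
  "scalar_product scale g \<longleftrightarrow>
     (\<forall>v. Vector_Spaces.linear scale (*) (\<lambda>w. g v w)) \<and>
     (\<forall>w. Vector_Spaces.linear scale (*) (\<lambda>v. g v w)) \<and>
     (\<forall>v w. g v w = g w v) \<and>
     (\<forall>v. (\<forall>w. g v w = 0) \<longrightarrow> v = 0)"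

text \<open>Bases are indexed by \<open>0, \<dots>, d - 1\<close>; only the values of \<open>x\<close> below \<open>d\<close> matter.\<close>

definition is_indexed_basis ::
  "('f::field \<Rightarrow> 'v::ab_group_add \<Rightarrow> 'v) \<Rightarrow> nat \<Rightarrow> (nat \<Rightarrow> 'v) \<Rightarrow> bool" where
  "is_indexed_basis scale d x \<longleftrightarrow>
     inj_on x {..<d} \<and>
     \<not> module.dependent scale (x ` {..<d}) \<and>
     module.span scale (x ` {..<d}) = UNIV"

definition gram :: "('v \<Rightarrow> 'v \<Rightarrow> 'f) \<Rightarrow> 'v list \<Rightarrow> 'v list \<Rightarrow> 'f mat" where
  "gram g vs ws = mat (length vs) (length ws) (\<lambda>(i, j). g (vs ! i) (ws ! j))"

definition reciprocal ::
  "('v \<Rightarrow> 'v \<Rightarrow> 'f::field) \<Rightarrow> nat \<Rightarrow> (nat \<Rightarrow> 'v) \<Rightarrow> nat \<Rightarrow> 'v" where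
  "reciprocal g d x i = (THE v. \<forall>j<d. g v (x j) = (if i = j then 1 else 0))"


section \<open>The exterior algebra\<close>

text \<open>The type \<open>'v list \<Rightarrow>\<^sub>0 'f\<close> is the free associative algebra on the set of all vectors:
  its basis consists of the words in vectors, and words are multiplied by concatenation.\<close>

definition word_scale :: "'f::field \<Rightarrow> ('v list \<Rightarrow>\<^sub>0 'f) \<Rightarrow> ('v list \<Rightarrow>\<^sub>0 'f)" where
  "word_scale c a = Poly_Mapping.map (\<lambda>y. c * y) a"

lemma lookup_word_scale: "Poly_Mapping.lookup (word_scale c a) w = c * Poly_Mapping.lookup a w"
  by (simp add: word_scale_def Poly_Mapping.map.rep_eq when_def)

lemma vector_space_word_scale: "vector_space word_scale"
  by unfold_locales (auto intro!: poly_mapping_eqI simp: lookup_word_scale lookup_add algebra_simps)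

text \<open>The two-sided ideal generated by the elements \<open>(a + b) - a - b\<close>, \<open>(c \<cdot> a) - c a\<close> and
  \<open>a a\<close>. The first two kinds make the quotient the tensor algebra; the third turns the tensor
  algebra into the exterior algebra.\<close>

definition ext_ideal ::
  "('f::field \<Rightarrow> 'v::ab_group_add \<Rightarrow> 'v) \<Rightarrow> ('v list \<Rightarrow>\<^sub>0 'f) set" where
  "ext_ideal scale = module.span word_scale
     ({Poly_Mapping.single (us @ [a + b] @ vs) 1 - Poly_Mapping.single (us @ [a] @ vs) 1
         - Poly_Mapping.single (us @ [b] @ vs) 1 | us vs a b. True} \<union>
      {Poly_Mapping.single (us @ [scale c a] @ vs) 1 - Poly_Mapping.single (us @ [a] @ vs) c
         | us vs c a. True} \<union>
      {Poly_Mapping.single (us @ [a, a] @ vs) 1 | us vs a. True})"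

text \<open>Multivectors are cosets of this ideal.\<close>

type_synonym ('f, 'v) multivector = "('v list \<Rightarrow>\<^sub>0 'f) set"

definition ext_coset ::
  "('f::field \<Rightarrow> 'v::ab_group_add \<Rightarrow> 'v) \<Rightarrow> ('v list \<Rightarrow>\<^sub>0 'f) \<Rightarrow> ('f, 'v) multivector" where
  "ext_coset scale a = {a + n | n. n \<in> ext_ideal scale}"

definition ext_algebra ::
  "('f::field \<Rightarrow> 'v::ab_group_add \<Rightarrow> 'v) \<Rightarrow> ('f, 'v) multivector set" where
  "ext_algebra scale = range (ext_coset scale)"

definition ext_power ::
  "('f::field \<Rightarrow> 'v::ab_group_add \<Rightarrow> 'v) \<Rightarrow> nat \<Rightarrow> ('f, 'v) multivector set" where
  "ext_power scale p =
     ext_coset scale ` {a. \<forall>vs \<in> Poly_Mapping.keys a. length vs = p}"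

text \<open>The product \<open>v\<^sub>1 \<and> \<dots> \<and> v\<^sub>p\<close> of a list of vectors; the empty product is the unit.\<close>

definition wedge ::
  "('f::field \<Rightarrow> 'v::ab_group_add \<Rightarrow> 'v) \<Rightarrow> 'v list \<Rightarrow> ('f, 'v) multivector" where
  "wedge scale vs = ext_coset scale (Poly_Mapping.single vs 1)"

definition ext_add ::
  "('f::field, 'v) multivector \<Rightarrow> ('f, 'v) multivector \<Rightarrow> ('f, 'v) multivector" where
  "ext_add r s = {a + b | a b. a \<in> r \<and> b \<in> s}"

text \<open>Adding the ideal again matters only for \<open>c = 0\<close>, where \<open>{c a | a \<in> r}\<close> is \<open>{0}\<close>.\<close>

definition ext_scale ::
  "('f::field \<Rightarrow> 'v::ab_group_add \<Rightarrow> 'v) \<Rightarrow> 'f \<Rightarrow> ('f, 'v) multivector \<Rightarrow> ('f, 'v) multivector"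
  where
  "ext_scale scale c r = {word_scale c a + n | a n. a \<in> r \<and> n \<in> ext_ideal scale}"


section \<open>Extension of the scalar product\<close>

definition ext_bilinear_on ::
  "('f::field \<Rightarrow> 'v::ab_group_add \<Rightarrow> 'v) \<Rightarrow> ('f, 'v) multivector set
     \<Rightarrow> (('f, 'v) multivector \<Rightarrow> ('f, 'v) multivector \<Rightarrow> 'f) \<Rightarrow> bool" where
  "ext_bilinear_on scale S B \<longleftrightarrow>
     (\<forall>r\<in>S. \<forall>s\<in>S. \<forall>t\<in>S. B (ext_add r s) t = B r t + B s t \<and>
                          B t (ext_add r s) = B t r + B t s) \<and>
     (\<forall>c. \<forall>r\<in>S. \<forall>s\<in>S. B (ext_scale scale c r) s = c * B r s \<and>
                         B r (ext_scale scale c s) = c * B r s)"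

definition extends_scalar_product ::
  "('f::field \<Rightarrow> 'v::ab_group_add \<Rightarrow> 'v) \<Rightarrow> ('v \<Rightarrow> 'v \<Rightarrow> 'f)
     \<Rightarrow> (('f, 'v) multivector \<Rightarrow> ('f, 'v) multivector \<Rightarrow> 'f) \<Rightarrow> bool" where
  "extends_scalar_product scale g B \<longleftrightarrow>
     (\<forall>p. ext_bilinear_on scale (ext_power scale p) B \<and>
          (\<forall>vs ws. length vs = p \<and> length ws = p \<longrightarrow>
             B (wedge scale vs) (wedge scale ws) = det (gram g vs ws)))"

text \<open>The extension is unique on each exterior power. \<open>SOME\<close> is used instead of \<open>THE\<close> because
  the values on pairs of different degrees, and outside the exterior algebra, are left open.\<close>

definition ext_scalar_product ::
  "('f::field \<Rightarrow> 'v::ab_group_add \<Rightarrow> 'v) \<Rightarrow> ('v \<Rightarrow> 'v \<Rightarrow> 'f)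
     \<Rightarrow> ('f, 'v) multivector \<Rightarrow> ('f, 'v) multivector \<Rightarrow> 'f" where
  "ext_scalar_product scale g = (SOME B. extends_scalar_product scale g B)"


section \<open>The Hodge star\<close>

definition is_hodge_star ::
  "('f::field \<Rightarrow> 'v::ab_group_add \<Rightarrow> 'v) \<Rightarrow> ('v \<Rightarrow> 'v \<Rightarrow> 'f) \<Rightarrow> nat \<Rightarrow> (nat \<Rightarrow> 'v)
     \<Rightarrow> (('f, 'v) multivector \<Rightarrow> ('f, 'v) multivector) \<Rightarrow> bool" where
  "is_hodge_star scale g d x h \<longleftrightarrow>
     (\<forall>r\<in>ext_algebra scale. h r \<in> ext_algebra scale) \<and>
     (\<forall>r\<in>ext_algebra scale. \<forall>s\<in>ext_algebra scale. h (ext_add r s) = ext_add (h r) (h s)) \<and>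
     (\<forall>c. \<forall>r\<in>ext_algebra scale. h (ext_scale scale c r) = ext_scale scale c (h r)) \<and>
     (\<forall>n \<rho>. n \<le> d \<and> \<rho> permutes {..<d} \<longrightarrow>
        h (wedge scale (map (\<lambda>k. x (\<rho> k)) [0..<n])) =
          ext_scale scale (of_int (sign \<rho>))
            (wedge scale (map (\<lambda>k. reciprocal g d x (\<rho> k)) [n..<d])))"

text \<open>Such a map is unique on the exterior algebra; its values elsewhere are left open.\<close>

definition hodge_star ::
  "('f::field \<Rightarrow> 'v::ab_group_add \<Rightarrow> 'v) \<Rightarrow> ('v \<Rightarrow> 'v \<Rightarrow> 'f) \<Rightarrow> nat \<Rightarrow> (nat \<Rightarrow> 'v)
     \<Rightarrow> ('f, 'v) multivector \<Rightarrow> ('f, 'v) multivector" where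
  "hodge_star scale g d x = (SOME h. is_hodge_star scale g d x h)"

end

theory Submission
  imports Defs
begin

text \<open>Write \<open>\<iota>\<^sub>v\<close> for contraction with \<open>g v\<close>, the antiderivation of the exterior algebra with
  \<open>\<iota>\<^sub>v (u) = g v u\<close>, and \<open>Z = x\<^sub>1\<^sup>\<bottom> \<and> \<dots> \<and> x\<^sub>d\<^sup>\<bottom>\<close>. Contracting \<open>Z\<close> with a basis vector \<open>x\<^sub>i\<close> deletes the factor
  \<open>x\<^sub>i\<^sup>\<bottom>\<close>, so the Hodge star is
  \<open>\<ast>(v\<^sub>1 \<and> \<dots> \<and> v\<^sub>p) = \<iota>\<^bsub>v\<^sub>p\<^esub> \<dots> \<iota>\<^bsub>v\<^sub>1\<^esub> Z\<close> for arbitrary vectors \<open>v\<^sub>i\<close>. The extended scalar product has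
  the same shape: for \<open>s\<close> of degree \<open>p\<close>, Laplace expansion gives
  \<open>g(v\<^sub>1 \<and> \<dots> \<and> v\<^sub>p, s) = \<iota>\<^bsub>v\<^sub>p\<^esub> \<dots> \<iota>\<^bsub>v\<^sub>1\<^esub> s\<close>
  (\<open>pairing_words\<close>). Hence \<open>g(r \<and> t, s) = g(t, \<iota>\<^sub>r s)\<close>, and in particular
  \<open>g(\<ast>s, \<ast>r) = g(r \<and> \<ast>s, Z)\<close>.

  The heart of the proof is the identity \<open>r \<and> \<ast>s = g(r, s) Z\<close> for \<open>r\<close>, \<open>s\<close> of the same degree
  (\<open>lwedge_star\<close>). It rests on \<open>\<iota>\<^sub>v\<close> being an antiderivation and on \<open>u \<and> Z = 0\<close> for every
  vector \<open>u\<close>. It follows that \<open>g(\<ast>s, \<ast>r) = g(r, s) g(Z, Z)\<close> (\<open>pairing_star\<close>). Taking for both \<open>r\<close>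
  and \<open>s\<close> the product \<open>x\<^sub>1 \<and> \<dots> \<and> x\<^sub>d\<close>, whose star is \<open>1\<close>, the same identity gives
  \<open>x\<^sub>1 \<and> \<dots> \<and> x\<^sub>d = G Z\<close>; pairing this with \<open>Z\<close> yields \<open>G g(Z, Z) = 1\<close> (\<open>top_form_norm\<close>), which
  is the factor \<open>G\<close> of the theorem.

  Both the extended scalar product and the Hodge star are given by choice from a specification,
  so that existence and uniqueness have to be shown as well. Existence is obtained by defining all
  maps on the free algebra of words and checking that they respect the ideal of relations;
  the Hodge star is unique on the exterior algebra because modulo the ideal every word is a
  combination of words in distinct basis vectors (\<open>word_in_span\<close>). This spanning property also
  gives \<open>u \<and> Z = 0\<close>.\<close>

section \<open>Linear maps on the free algebra of words\<close>

interpretation words: vector_space word_scale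
  by (rule vector_space_word_scale)

lemmas words_algebra_simps =
  words.scale_right_diff_distrib words.scale_right_distrib words.scale_left_distrib algebra_simps

abbreviation word :: "'v list \<Rightarrow> ('v list \<Rightarrow>\<^sub>0 'f::field)" where
  "word w \<equiv> Poly_Mapping.single w 1"

lemma word_scale_single: "word_scale c (Poly_Mapping.single w b) = Poly_Mapping.single w (c * b)"
  by (rule poly_mapping_eqI) (simp add: lookup_word_scale lookup_single when_def)

text \<open>Linear identities on the free algebra are checked on words by way of this span; keeping only the
  words that occur in \<open>a\<close> lets the same rules serve homogeneous elements.\<close>

lemma in_span_words: "a \<in> words.span (word ` Poly_Mapping.keys a)"
proof -
  have "a = (\<Sum>w\<in>Poly_Mapping.keys a. word_scale (Poly_Mapping.lookup a w) (word w))"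
    by (rule poly_mapping_eqI)
      (auto simp: lookup_sum lookup_word_scale lookup_single when_def in_keys_iff
        if_distrib cong: if_cong)
  then show ?thesis
    by (metis (no_types, lifting) image_eqI words.span_base words.span_scale words.span_sum)
qed

definition lin_ext ::
  "('f::field \<Rightarrow> 'w::ab_group_add \<Rightarrow> 'w) \<Rightarrow> ('v list \<Rightarrow> 'w) \<Rightarrow> ('v list \<Rightarrow>\<^sub>0 'f) \<Rightarrow> 'w" where
  "lin_ext sc f a = (\<Sum>w\<in>Poly_Mapping.keys a. sc (Poly_Mapping.lookup a w) (f w))"

lemma lin_ext_superset:
  assumes "vector_space sc" "finite K" "Poly_Mapping.keys a \<subseteq> K"
  shows "lin_ext sc f a = (\<Sum>w\<in>K. sc (Poly_Mapping.lookup a w) (f w))"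
proof -
  interpret vector_space sc by fact
  show ?thesis
    unfolding lin_ext_def by (rule sum.mono_neutral_left) (use assms in \<open>auto simp: in_keys_iff\<close>)
qed

lemma linear_lin_ext:
  assumes "vector_space sc"
  shows "Vector_Spaces.linear word_scale sc (lin_ext sc f)"
proof -
  interpret vector_space sc by fact
  have "lin_ext sc f (a + b) = lin_ext sc f a + lin_ext sc f b" for a b
    using lin_ext_superset[OF assms, of "Poly_Mapping.keys a \<union> Poly_Mapping.keys b" "a + b"]
      lin_ext_superset[OF assms, of "Poly_Mapping.keys a \<union> Poly_Mapping.keys b" a]
      lin_ext_superset[OF assms, of "Poly_Mapping.keys a \<union> Poly_Mapping.keys b" b]
    by (simp add: keys_add lookup_add scale_left_distrib sum.distrib)
  moreover have "lin_ext sc f (word_scale c a) = sc c (lin_ext sc f a)" for c a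
    using lin_ext_superset[OF assms, of "Poly_Mapping.keys a" "word_scale c a"]
    by (auto simp: lin_ext_def lookup_word_scale scale_sum_right in_keys_iff subset_iff)
  ultimately show ?thesis
    by (simp add: Vector_Spaces.linear_iff assms vector_space_word_scale)
qed

lemma lin_ext_word [simp]:
  assumes "vector_space sc"
  shows "lin_ext sc f (word w) = f w"
proof -
  interpret vector_space sc by fact
  show ?thesis by (simp add: lin_ext_def)
qed

lemma vector_space_field: "vector_space ((*) :: 'f::field \<Rightarrow> 'f \<Rightarrow> 'f)"
  by unfold_locales (auto simp: algebra_simps)

lemma linearI:
  assumes "vector_space s1" "vector_space s2"
    and "\<And>x y. f (x + y) = f x + f y" "\<And>c x. f (s1 c x) = s2 c (f x)"
  shows "Vector_Spaces.linear s1 s2 f"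
  using assms by (simp add: Vector_Spaces.linear_iff)

lemma linear_rules:
  assumes "Vector_Spaces.linear s1 s2 f"
  shows "f (a + b) = f a + f b" "f (a - b) = f a - f b" "f (s1 c a) = s2 c (f a)"
    "f 0 = 0" "f (sum h A) = (\<Sum>i\<in>A. f (h i))"
proof -
  interpret Vector_Spaces.linear s1 s2 f by fact
  show "f (a + b) = f a + f b" "f (a - b) = f a - f b" "f (s1 c a) = s2 c (f a)"
    "f 0 = 0" "f (sum h A) = (\<Sum>i\<in>A. f (h i))"
    by (simp_all add: add diff scale zero sum)
qed

lemma linear_in_subspace:
  assumes lin: "Vector_Spaces.linear word_scale word_scale F"
    and sub: "words.subspace T" and gen: "\<And>w. w \<in> A \<Longrightarrow> F w \<in> T" and a: "a \<in> words.span A"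
  shows "F a \<in> T"
  using a
proof (induction rule: words.span_induct_alt)
  case base
  then show ?case using sub by (simp add: linear_rules(4)[OF lin] words.subspace_0)
next
  case (step c x y)
  then show ?case using sub gen
    by (simp add: linear_rules(1,3)[OF lin] words.subspace_add words.subspace_scale)
qed

lemma linear_eq_on_words:
  assumes F: "Vector_Spaces.linear word_scale sc F" and G: "Vector_Spaces.linear word_scale sc G"
    and eq: "\<And>w. w \<in> Poly_Mapping.keys a \<Longrightarrow> F (word w) = G (word w)"
  shows "F a = G a"
proof -
  interpret vector_space_pair word_scale sc
    using F vector_space_word_scale by (simp add: Vector_Spaces.linear_iff vector_space_pair_def)
  show ?thesis
    by (rule linear_eq_on[OF F G in_span_words]) (use eq in auto)
qed

text \<open>The free algebra is graded by word length; \<open>homogeneous p\<close> maps onto the \<open>p\<close>-th exterior power.\<close>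

definition homogeneous :: "nat \<Rightarrow> ('v list \<Rightarrow>\<^sub>0 'f::field) set" where
  "homogeneous n = {a. \<forall>w\<in>Poly_Mapping.keys a. length w = n}"

lemma subspace_homogeneous: "words.subspace (homogeneous n)"
proof -
  have "Poly_Mapping.keys (word_scale c a) \<subseteq> Poly_Mapping.keys a" for c and a :: "'w list \<Rightarrow>\<^sub>0 'k::field"
    by (auto simp: in_keys_iff lookup_word_scale)
  then show ?thesis
    unfolding words.subspace_def homogeneous_def
    using keys_add by (fastforce dest: subsetD)
qed

lemma word_homogeneous: "length w = n \<Longrightarrow> word w \<in> homogeneous n"
  by (simp add: homogeneous_def)

lemma homogeneous_in_span: "a \<in> homogeneous n \<Longrightarrow> a \<in> words.span (word ` {w. length w = n})"
  using in_span_words[of a] words.span_mono[of "word ` Poly_Mapping.keys a" "word ` {w. length w = n}"]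
  by (auto simp: homogeneous_def)

lemma homogeneous_0: "a \<in> homogeneous 0 \<Longrightarrow> a = word_scale (Poly_Mapping.lookup a []) (word [])"
  by (rule poly_mapping_eqI)
    (force simp: homogeneous_def lookup_word_scale lookup_single when_def not_in_keys_iff_lookup_eq_zero[symmetric])


section \<open>Left multiplication and contraction\<close>

definition lwedge :: "'v list \<Rightarrow> ('v list \<Rightarrow>\<^sub>0 'f::field) \<Rightarrow> ('v list \<Rightarrow>\<^sub>0 'f)" where
  "lwedge us = lin_ext word_scale (\<lambda>w. word (us @ w))"

lemma linear_lwedge: "Vector_Spaces.linear word_scale word_scale (lwedge us)"
  unfolding lwedge_def by (rule linear_lin_ext[OF vector_space_word_scale])

lemmas lwedge_simps [simp] = linear_rules[OF linear_lwedge]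

lemma lwedge_word [simp]: "lwedge us (word w) = word (us @ w)"
  by (simp add: lwedge_def vector_space_word_scale)

lemma lwedge_single [simp]: "lwedge us (Poly_Mapping.single w c) = Poly_Mapping.single (us @ w) c"
  using lwedge_simps(3)[of us c "word w"] by (simp add: word_scale_single)

lemma lwedge_append: "lwedge (us @ vs) a = lwedge us (lwedge vs a)"
  by (rule linear_eq_on_words[OF linear_lwedge, where G = "\<lambda>a. lwedge us (lwedge vs a)"])
    (auto intro!: linearI vector_space_word_scale)

lemma lwedge_Nil [simp]: "lwedge [] a = a"
  by (rule linear_eq_on_words[OF linear_lwedge, where G = "\<lambda>a. a"])
    (auto intro!: linearI vector_space_word_scale)

lemma lwedge_homogeneous: "a \<in> homogeneous n \<Longrightarrow> lwedge us a \<in> homogeneous (length us + n)"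
  by (rule linear_in_subspace[OF linear_lwedge subspace_homogeneous _ homogeneous_in_span])
    (auto intro!: word_homogeneous simp: homogeneous_def)

locale scalar_product_space = vector_space scale
  for scale :: "'f::field \<Rightarrow> 'v::ab_group_add \<Rightarrow> 'v" +
  fixes g :: "'v \<Rightarrow> 'v \<Rightarrow> 'f"
  assumes scalar_product: "scalar_product scale g"
begin

lemma g_simps [simp]:
  "g (u + v) w = g u w + g v w" "g w (u + v) = g w u + g w v"
  "g (scale c v) w = c * g v w" "g w (scale c v) = c * g w v" "g 0 w = 0" "g w 0 = 0"
proof -
  have l: "Vector_Spaces.linear scale (*) (g w)" "Vector_Spaces.linear scale (*) (\<lambda>v. g v w)" for w
    using scalar_product by (auto simp: scalar_product_def)
  show "g (u + v) w = g u w + g v w" "g w (u + v) = g w u + g w v"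
    "g (scale c v) w = c * g v w" "g w (scale c v) = c * g w v" "g 0 w = 0" "g w 0 = 0"
    using linear_rules(1,3,4)[OF l(1)] linear_rules(1,3,4)[OF l(2)] by simp_all
qed

lemma g_commute: "g v w = g w v"
  using scalar_product by (auto simp: scalar_product_def)

lemma g_nondegenerate: "(\<And>w. g v w = 0) \<Longrightarrow> v = 0"
  using scalar_product by (auto simp: scalar_product_def)

text \<open>Contraction with the covector \<open>g v\<close>, determined by the antiderivation rule.\<close>

primrec contract_word :: "'v \<Rightarrow> 'v list \<Rightarrow> ('v list \<Rightarrow>\<^sub>0 'f)" where
  "contract_word v [] = 0"
| "contract_word v (u # us) = word_scale (g v u) (word us) - lwedge [u] (contract_word v us)"

definition contract :: "'v \<Rightarrow> ('v list \<Rightarrow>\<^sub>0 'f) \<Rightarrow> ('v list \<Rightarrow>\<^sub>0 'f)" where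
  "contract v = lin_ext word_scale (contract_word v)"

lemma linear_contract: "Vector_Spaces.linear word_scale word_scale (contract v)"
  unfolding contract_def by (rule linear_lin_ext[OF vector_space_word_scale])

lemmas contract_simps [simp] = linear_rules[OF linear_contract]

lemma contract_word_eq [simp]: "contract v (word w) = contract_word v w"
  by (simp add: contract_def vector_space_word_scale)

lemma contract_lwedge: "contract v (lwedge [u] a) = word_scale (g v u) a - lwedge [u] (contract v a)"
  by (rule linear_eq_on_words[where sc = word_scale and F = "\<lambda>a. contract v (lwedge [u] a)"
        and G = "\<lambda>a. word_scale (g v u) a - lwedge [u] (contract v a)"])
    (auto intro!: linearI vector_space_word_scale simp: words_algebra_simps)

text \<open>The square vanishes exactly in the free algebra, since two applications of the antiderivation
  rule make the mixed terms cancel. It is the reason why iterated contraction is an alternating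
  function of the vectors contracted with.\<close>

lemma contract_contract [simp]: "contract v (contract v a) = 0"
proof -
  have *: "contract v (contract_word v w) = 0" for w
    by (induction w) (simp_all add: contract_lwedge)
  show ?thesis
    by (rule linear_eq_on_words[where sc = word_scale and F = "\<lambda>a. contract v (contract v a)"
          and G = "\<lambda>_. 0"])
      (auto intro!: linearI vector_space_word_scale simp: *)
qed

lemma contract_add: "contract (u + v) a = contract u a + contract v a"
proof -
  have *: "contract_word (u + v) w = contract_word u w + contract_word v w" for w
    by (induction w) (auto simp: words_algebra_simps)
  show ?thesis
    by (rule linear_eq_on_words[where sc = word_scale and F = "contract (u + v)"
          and G = "\<lambda>a. contract u a + contract v a"])
      (auto intro!: linearI vector_space_word_scale simp: * words_algebra_simps)
qed

lemma contract_scale: "contract (scale c v) a = word_scale c (contract v a)"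
proof -
  have *: "contract_word (scale c v) w = word_scale c (contract_word v w)" for w
    by (induction w) (auto simp: words_algebra_simps)
  show ?thesis
    by (rule linear_eq_on_words[where sc = word_scale and F = "contract (scale c v)"
          and G = "\<lambda>a. word_scale c (contract v a)"])
      (auto intro!: linearI vector_space_word_scale simp: *
        words.scale_right_diff_distrib words.scale_right_distrib mult.commute)
qed

lemma contract_homogeneous: "a \<in> homogeneous n \<Longrightarrow> contract v a \<in> homogeneous (n - 1)"
proof -
  have *: "contract_word v w \<in> homogeneous (length w - 1)" for w
  proof (induction w)
    case Nil
    then show ?case by (simp add: homogeneous_def)
  next
    case (Cons u w)
    have "lwedge [u] (contract_word v w) \<in> homogeneous (length w)"
      using lwedge_homogeneous[OF Cons, of "[u]"]
      by (cases w) (auto simp: words.subspace_0[OF subspace_homogeneous])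
    then show ?case
      by (auto intro!: words.subspace_diff[OF subspace_homogeneous]
          words.subspace_scale[OF subspace_homogeneous] word_homogeneous)
  qed
  show "a \<in> homogeneous n \<Longrightarrow> contract v a \<in> homogeneous (n - 1)"
    by (rule linear_in_subspace[OF linear_contract subspace_homogeneous _ homogeneous_in_span])
      (use * in auto)
qed

lemma linear_fold_contract: "Vector_Spaces.linear word_scale word_scale (fold contract us)"
proof (induction us)
  case (Cons u us)
  show ?case
    by (rule linearI) (simp_all add: linear_rules[OF Cons] vector_space_word_scale)
qed (rule linearI; simp add: vector_space_word_scale)

lemmas fold_contract_simps [simp] = linear_rules[OF linear_fold_contract]

lemma fold_contract_homogeneous:
  "a \<in> homogeneous n \<Longrightarrow> fold contract us a \<in> homogeneous (n - length us)"
proof (induction us arbitrary: a n)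
  case (Cons u us)
  then show ?case using Cons.IH[OF contract_homogeneous[OF Cons.prems]] by simp
qed simp


text \<open>In closed form contraction deletes one letter at a time with alternating sign, just as the Laplace
  expansion of a determinant along its first row deletes columns.\<close>

lemma contract_word_sum:
  "contract_word v w =
     (\<Sum>i<length w. word_scale ((-1) ^ i * g v (w ! i)) (word (take i w @ drop (Suc i) w)))"
proof (induction w)
  case (Cons u w)
  show ?case
    by (simp add: Cons sum.lessThan_Suc_shift words.scale_minus_left sum_negf del: sum.lessThan_Suc)
qed simp


section \<open>The ideal of relations\<close>

lemma ext_ideal_add: "lwedge us (word ((a + b) # vs) - word (a # vs) - word (b # vs)) \<in> ext_ideal scale"
  unfolding ext_ideal_def by (rule words.span_base) (auto simp: append_eq_append_conv2; blast)

lemma ext_ideal_scale: "lwedge us (word (scale c a # vs) - word_scale c (word (a # vs))) \<in> ext_ideal scale"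
  unfolding ext_ideal_def
  by (rule words.span_base) (auto simp: word_scale_single; blast)

lemma ext_ideal_square: "lwedge us (word (a # a # vs)) \<in> ext_ideal scale"
  unfolding ext_ideal_def by (rule words.span_base) (auto; blast)

lemma subspace_ext_ideal: "words.subspace (ext_ideal scale)"
  by (simp add: ext_ideal_def)

text \<open>The relations are presented as left multiples of relations at the front of a word, so that
  maps commuting with \<open>lwedge\<close> up to the antiderivation rule need to be examined only there.\<close>

lemma ext_ideal_induct [consumes 1, case_names sub add scale square]:
  assumes a: "a \<in> ext_ideal scale"
    and sub: "words.subspace {a. P a}"
    and add: "\<And>us vs a b. P (lwedge us (word ((a + b) # vs) - word (a # vs) - word (b # vs)))"
    and scale: "\<And>us vs c a. P (lwedge us (word (scale c a # vs) - word_scale c (word (a # vs))))"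
    and square: "\<And>us vs a. P (lwedge us (word (a # a # vs)))"
  shows "P a"
  using a unfolding ext_ideal_def
proof (rule words.span_induct[OF _ sub], elim UnE)
  fix x :: "'v list \<Rightarrow>\<^sub>0 'f"
  assume "x \<in> {word (us @ [a + b] @ vs) - word (us @ [a] @ vs) - word (us @ [b] @ vs) | us vs a b. True}"
  then show "P x" using add by auto
next
  fix x :: "'v list \<Rightarrow>\<^sub>0 'f"
  assume "x \<in> {word (us @ [scale c a] @ vs) - Poly_Mapping.single (us @ [a] @ vs) c | us vs c a. True}"
  then show "P x" using scale by (auto simp: word_scale_single)
next
  fix x :: "'v list \<Rightarrow>\<^sub>0 'f"
  assume "x \<in> {word (us @ [a, a] @ vs) | us vs a. True}"
  then show "P x" using square by auto
qed

text \<open>The universal property of the exterior algebra: a multilinear alternating function of words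
  factors through the quotient.\<close>

lemma lin_ext_ideal:
  assumes sc: "vector_space sc"
    and add: "\<And>us vs a b. f (us @ (a + b) # vs) = f (us @ a # vs) + f (us @ b # vs)"
    and scale: "\<And>us vs c a. f (us @ scale c a # vs) = sc c (f (us @ a # vs))"
    and square: "\<And>us vs a. f (us @ a # a # vs) = 0"
    and a: "a \<in> ext_ideal scale"
  shows "lin_ext sc f a = 0"
proof -
  interpret sc: vector_space sc by fact
  note lin = linear_rules[OF linear_lin_ext[OF sc]]
  show ?thesis
    using a
    by (induction rule: ext_ideal_induct)
      (simp_all add: words.subspace_def lin sc add scale square)
qed

lemma lwedge_ideal: "a \<in> ext_ideal scale \<Longrightarrow> lwedge us a \<in> ext_ideal scale"
proof (induction rule: ext_ideal_induct)
  case sub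
  show ?case
    by (auto simp: words.subspace_def words.subspace_0[OF subspace_ext_ideal]
        words.subspace_add[OF subspace_ext_ideal] words.subspace_scale[OF subspace_ext_ideal])
qed (simp_all only: lwedge_append[symmetric] ext_ideal_add ext_ideal_scale ext_ideal_square)

lemma lwedge_add_ideal: "lwedge [u + v] a - lwedge [u] a - lwedge [v] a \<in> ext_ideal scale"
proof (rule linear_in_subspace[where F = "\<lambda>a. lwedge [u + v] a - lwedge [u] a - lwedge [v] a"])
  fix w :: "'v list \<Rightarrow>\<^sub>0 'f" assume "w \<in> word ` Poly_Mapping.keys a"
  then show "lwedge [u + v] w - lwedge [u] w - lwedge [v] w \<in> ext_ideal scale"
    using ext_ideal_add[of "[]"] by auto
qed (auto intro!: linearI vector_space_word_scale subspace_ext_ideal in_span_words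
    simp: words_algebra_simps)

lemma lwedge_scale_ideal: "lwedge [scale c u] a - word_scale c (lwedge [u] a) \<in> ext_ideal scale"
proof (rule linear_in_subspace[where F = "\<lambda>a. lwedge [scale c u] a - word_scale c (lwedge [u] a)"])
  fix w :: "'v list \<Rightarrow>\<^sub>0 'f" assume "w \<in> word ` Poly_Mapping.keys a"
  then show "lwedge [scale c u] w - word_scale c (lwedge [u] w) \<in> ext_ideal scale"
    using ext_ideal_scale[of "[]"] by auto
qed (auto intro!: linearI vector_space_word_scale subspace_ext_ideal in_span_words
    simp: words_algebra_simps)

lemma lwedge_square_ideal: "lwedge [u, u] a \<in> ext_ideal scale"
  by (rule linear_in_subspace[OF linear_lwedge subspace_ext_ideal _ in_span_words])
    (use ext_ideal_square[of "[]"] in auto)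

text \<open>At the front of a word, contraction turns a linearity relation into one of the same kind and sends
  the square \<open>a a w\<close> to \<open>a a (\<iota>\<^sub>v w)\<close>, because the two terms in which a letter \<open>a\<close> is removed
  cancel. The antiderivation rule carries this over to relations behind a prefix.\<close>

lemma contract_ideal:
  assumes "a \<in> ext_ideal scale"
  shows "contract v a \<in> ext_ideal scale"
proof -
  note closed = words.subspace_0[OF subspace_ext_ideal] words.subspace_add[OF subspace_ext_ideal]
    words.subspace_diff[OF subspace_ext_ideal] words.subspace_scale[OF subspace_ext_ideal]
    words.subspace_neg[OF subspace_ext_ideal]
  have step: "contract v (lwedge us b) \<in> ext_ideal scale"
    if "b \<in> ext_ideal scale" "contract v b \<in> ext_ideal scale" for us b
  proof (induction us)
    case (Cons u us)
    have "lwedge (u # us) b = lwedge [u] (lwedge us b)"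
      using lwedge_append[of "[u]" us b] by simp
    then show ?case
      by (simp only: contract_lwedge) (intro closed lwedge_ideal that Cons)
  qed (simp add: that)
  show ?thesis
    using assms
  proof (induction rule: ext_ideal_induct)
    case sub
    show ?case by (auto simp: words.subspace_def closed)
  next
    case (add us vs a b)
    have "contract v (word ((a + b) # vs) - word (a # vs) - word (b # vs)) =
      - (lwedge [a + b] (contract_word v vs) - lwedge [a] (contract_word v vs) - lwedge [b] (contract_word v vs))"
      by (simp add: words_algebra_simps)
    also have "\<dots> \<in> ext_ideal scale"
      by (intro closed lwedge_add_ideal)
    finally show ?case
      using step ext_ideal_add[of "[]" a b vs] by (simp only: lwedge_Nil)
  next
    case (scale us vs c a)
    have "contract v (word (scale c a # vs) - word_scale c (word (a # vs))) =
      - (lwedge [scale c a] (contract_word v vs) - word_scale c (lwedge [a] (contract_word v vs)))"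
      by (simp add: words_algebra_simps)
    also have "\<dots> \<in> ext_ideal scale"
      by (intro closed lwedge_scale_ideal)
    finally show ?case
      using step ext_ideal_scale[of "[]" c a vs] by (simp only: lwedge_Nil)
  next
    case (square us vs a)
    have "contract v (word (a # a # vs)) = lwedge [a, a] (contract_word v vs)"
      using lwedge_append[of "[a]" "[a]" "contract_word v vs"] by (simp add: words_algebra_simps)
    also have "\<dots> \<in> ext_ideal scale"
      by (rule lwedge_square_ideal)
    finally show ?case
      using step ext_ideal_square[of "[]" a vs] by (simp only: lwedge_Nil)
  qed
qed

text \<open>Every relation consists of nonempty words, so the scalar part is well defined on the quotient.\<close>

lemma lookup_Nil_ideal: "a \<in> ext_ideal scale \<Longrightarrow> Poly_Mapping.lookup a [] = 0"
  by (induction rule: ext_ideal_induct)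
    (auto simp: words.subspace_def lookup_add lookup_minus lookup_word_scale lookup_single)

lemma coset_eq_iff: "ext_coset scale a = ext_coset scale b \<longleftrightarrow> a - b \<in> ext_ideal scale"
proof
  assume "ext_coset scale a = ext_coset scale b"
  moreover have "a \<in> ext_coset scale a"
    using words.subspace_0[OF subspace_ext_ideal] by (force simp: ext_coset_def)
  ultimately show "a - b \<in> ext_ideal scale"
    by (auto simp: ext_coset_def)
next
  have *: "ext_coset scale a \<subseteq> ext_coset scale b" if "a - b \<in> ext_ideal scale" for a b
  proof
    fix x assume "x \<in> ext_coset scale a"
    then obtain n where "n \<in> ext_ideal scale" "x = a + n" by (auto simp: ext_coset_def)
    then have "x = b + ((a - b) + n)" "(a - b) + n \<in> ext_ideal scale"
      using that by (auto intro: words.subspace_add[OF subspace_ext_ideal])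
    then show "x \<in> ext_coset scale b" unfolding ext_coset_def by blast
  qed
  assume "a - b \<in> ext_ideal scale"
  then show "ext_coset scale a = ext_coset scale b"
    using *[of a b] *[of b a] words.subspace_neg[OF subspace_ext_ideal, of "a - b"] by auto
qed

lemma ext_add_coset: "ext_add (ext_coset scale a) (ext_coset scale b) = ext_coset scale (a + b)"
proof (intro equalityI subsetI)
  fix x assume "x \<in> ext_add (ext_coset scale a) (ext_coset scale b)"
  then obtain m n where "m \<in> ext_ideal scale" "n \<in> ext_ideal scale" "x = (a + m) + (b + n)"
    by (auto simp: ext_add_def ext_coset_def)
  then have "x = (a + b) + (m + n)" "m + n \<in> ext_ideal scale"
    by (auto intro: words.subspace_add[OF subspace_ext_ideal])
  then show "x \<in> ext_coset scale (a + b)" unfolding ext_coset_def by blast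
next
  fix x assume "x \<in> ext_coset scale (a + b)"
  then obtain n where "n \<in> ext_ideal scale" "x = (a + 0) + (b + n)"
    by (auto simp: ext_coset_def)
  then show "x \<in> ext_add (ext_coset scale a) (ext_coset scale b)"
    unfolding ext_add_def ext_coset_def using words.subspace_0[OF subspace_ext_ideal] by blast
qed

lemma ext_scale_coset: "ext_scale scale c (ext_coset scale a) = ext_coset scale (word_scale c a)"
proof (intro equalityI subsetI)
  fix x assume "x \<in> ext_scale scale c (ext_coset scale a)"
  then obtain m n where "m \<in> ext_ideal scale" "n \<in> ext_ideal scale" "x = word_scale c (a + m) + n"
    by (auto simp: ext_scale_def ext_coset_def)
  then have "x = word_scale c a + (word_scale c m + n)" "word_scale c m + n \<in> ext_ideal scale"
    by (auto intro: words.subspace_add[OF subspace_ext_ideal] words.subspace_scale[OF subspace_ext_ideal]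
        simp: words_algebra_simps)
  then show "x \<in> ext_coset scale (word_scale c a)" unfolding ext_coset_def by blast
next
  fix x assume "x \<in> ext_coset scale (word_scale c a)"
  then obtain n where "n \<in> ext_ideal scale" "x = word_scale c (a + 0) + n"
    by (auto simp: ext_coset_def)
  then show "x \<in> ext_scale scale c (ext_coset scale a)"
    unfolding ext_scale_def ext_coset_def using words.subspace_0[OF subspace_ext_ideal] by blast
qed

lemma fold_contract_ideal: "a \<in> ext_ideal scale \<Longrightarrow> fold contract us a \<in> ext_ideal scale"
  by (induction us arbitrary: a) (auto intro: contract_ideal)


section \<open>The scalar product of multivectors through contraction\<close>

text \<open>The coefficient at the empty word is the scalar part. Through iterated contraction bilinearity and
  compatibility with the relations are inherited from \<open>contract\<close> instead of being checked on
  determinants.\<close>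

definition pairing :: "('v list \<Rightarrow>\<^sub>0 'f) \<Rightarrow> ('v list \<Rightarrow>\<^sub>0 'f) \<Rightarrow> 'f" where
  "pairing a b = lin_ext (*) (\<lambda>us. Poly_Mapping.lookup (fold contract us b) []) a"

lemma pairing_word: "pairing (word us) b = Poly_Mapping.lookup (fold contract us b) []"
  by (simp add: pairing_def vector_space_field)

lemma linear_pairing_left: "Vector_Spaces.linear word_scale (*) (\<lambda>a. pairing a b)"
  unfolding pairing_def by (rule linear_lin_ext[OF vector_space_field])

lemma linear_pairing_right: "Vector_Spaces.linear word_scale (*) (pairing a)"
  by (rule linearI)
    (simp_all add: pairing_def lin_ext_def vector_space_field vector_space_word_scale
      lookup_add lookup_word_scale algebra_simps sum.distrib sum_distrib_left)

lemmas pairing_simps [simp] = linear_rules[OF linear_pairing_left] linear_rules[OF linear_pairing_right]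

text \<open>Left multiplication is adjoint to contraction. This holds by construction, as the letters of the
  left argument are contracted with in their order.\<close>

lemma pairing_lwedge: "pairing (lwedge us a) b = pairing a (fold contract us b)"
  by (rule linear_eq_on_words[where sc = "(*)" and F = "\<lambda>a. pairing (lwedge us a) b"
        and G = "\<lambda>a. pairing a (fold contract us b)"])
    (auto intro!: linearI vector_space_word_scale vector_space_field simp: pairing_word)

lemma pairing_ideal_left: "a \<in> ext_ideal scale \<Longrightarrow> pairing a b = 0"
  unfolding pairing_def
  by (rule lin_ext_ideal[OF vector_space_field])
    (simp_all add: contract_add contract_scale lookup_add lookup_word_scale)

lemma pairing_ideal_right: "b \<in> ext_ideal scale \<Longrightarrow> pairing a b = 0"
  by (rule linear_eq_on_words[where sc = "(*)" and F = "\<lambda>a. pairing a b" and G = "\<lambda>a. 0"])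
    (auto intro!: linearI vector_space_word_scale vector_space_field lookup_Nil_ideal
      fold_contract_ideal simp: pairing_word)

lemma pairing_words:
  "length us = length ws \<Longrightarrow> pairing (word us) (word ws) = det (gram g us ws)"
proof (induction us arbitrary: ws)
  case Nil
  then show ?case by (simp add: pairing_word gram_def)
next
  case (Cons u us)
  have minor: "mat_delete (gram g (u # us) ws) 0 j = gram g us (take j ws @ drop (Suc j) ws)"
    if "j < length ws" for j
    using that Cons.prems
    by (intro eq_matI) (auto simp: mat_delete_def gram_def nth_append min_def)
  have "pairing (word (u # us)) (word ws) = pairing (word us) (contract_word u ws)"
    by (simp add: pairing_word)
  also have "\<dots> = (\<Sum>j<length ws. (-1) ^ j * g u (ws ! j) * det (gram g us (take j ws @ drop (Suc j) ws)))"
    using Cons by (simp add: contract_word_sum)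
  also have "\<dots> = (\<Sum>j<length ws. gram g (u # us) ws $$ (0, j) * cofactor (gram g (u # us) ws) 0 j)"
    by (intro sum.cong refl) (simp add: cofactor_def minor, simp add: gram_def)
  also have "\<dots> = det (gram g (u # us) ws)"
    using Cons.prems
    by (intro laplace_expansion_row[symmetric]) (auto simp: gram_def)
  finally show ?case .
qed


text \<open>The pairing of representatives works for all degrees at once.\<close>

lemma extends_scalar_product_exists: "\<exists>B. extends_scalar_product scale g B"
proof -
  define rep where "rep r = (SOME a. ext_coset scale a = r)" for r
  define B where "B r s = pairing (rep r) (rep s)" for r s
  have rep: "rep (ext_coset scale a) - a \<in> ext_ideal scale" for a
    unfolding coset_eq_iff[symmetric] rep_def by (rule someI) (rule refl)
  have B: "B (ext_coset scale a) (ext_coset scale b) = pairing a b" for a b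
    using pairing_ideal_left[OF rep[of a]] pairing_ideal_right[OF rep[of b]]
    by (simp add: B_def)
  have "extends_scalar_product scale g B"
    unfolding extends_scalar_product_def ext_bilinear_on_def ext_power_def
    by (auto simp: ext_add_coset ext_scale_coset B wedge_def pairing_words)
  then show ?thesis by blast
qed

text \<open>Uniqueness of the extension: a bilinear form on \<open>homogeneous p\<close> is determined by its values on
  words.\<close>

lemma ext_scalar_product_coset:
  assumes a: "a \<in> homogeneous p" and b: "b \<in> homogeneous p"
  shows "ext_scalar_product scale g (ext_coset scale a) (ext_coset scale b) = pairing a b"
proof -
  define B where "B = ext_scalar_product scale g"
  have ext: "extends_scalar_product scale g B"
    unfolding B_def ext_scalar_product_def using extends_scalar_product_exists by (rule someI_ex)
  have power: "ext_coset scale a \<in> ext_power scale p" if "a \<in> homogeneous p" for a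
    using that by (auto simp: ext_power_def homogeneous_def)
  have bil: "ext_bilinear_on scale (ext_power scale p) B"
    using ext by (simp add: extends_scalar_product_def)
  have add_left: "B (ext_coset scale (a + b)) (ext_coset scale c) =
      B (ext_coset scale a) (ext_coset scale c) + B (ext_coset scale b) (ext_coset scale c)"
    and add_right: "B (ext_coset scale c) (ext_coset scale (a + b)) =
      B (ext_coset scale c) (ext_coset scale a) + B (ext_coset scale c) (ext_coset scale b)"
    if "a \<in> homogeneous p" "b \<in> homogeneous p" "c \<in> homogeneous p" for a b c
    using bil that unfolding ext_bilinear_on_def ext_add_coset[symmetric] by (simp_all add: power)
  have scale_left: "B (ext_coset scale (word_scale e a)) (ext_coset scale c) =
      e * B (ext_coset scale a) (ext_coset scale c)"
    and scale_right: "B (ext_coset scale c) (ext_coset scale (word_scale e a)) =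
      e * B (ext_coset scale c) (ext_coset scale a)"
    if "a \<in> homogeneous p" "c \<in> homogeneous p" for a c e
    using bil that unfolding ext_bilinear_on_def ext_scale_coset[symmetric] by (simp_all add: power)
  note hom = words.subspace_0[OF subspace_homogeneous] words.subspace_add[OF subspace_homogeneous]
    words.subspace_scale[OF subspace_homogeneous]
  have words: "B (ext_coset scale (word us)) (ext_coset scale (word ws)) = pairing (word us) (word ws)"
    if "length us = p" "length ws = p" for us ws
    using ext that by (auto simp: extends_scalar_product_def wedge_def pairing_words)
  have right: "b \<in> homogeneous p \<and>
      B (ext_coset scale (word us)) (ext_coset scale b) = pairing (word us) b"
    if us: "length us = p" for us
  proof -
    have us': "word us \<in> homogeneous p" using us by (rule word_homogeneous)
    show ?thesis
      using homogeneous_in_span[OF b]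
    proof (induction rule: words.span_induct_alt)
      case base
      show ?case
        using scale_right[OF hom(1) us', of 0] by (simp add: hom)
    next
      case (step c y z)
      then have "y \<in> homogeneous p" by (auto simp: word_homogeneous)
      then show ?case
        using step words[OF us] by (auto simp: hom add_right scale_right us')
    qed
  qed
  have "a \<in> homogeneous p \<and> B (ext_coset scale a) (ext_coset scale b) = pairing a b"
    using homogeneous_in_span[OF a]
  proof (induction rule: words.span_induct_alt)
    case base
    show ?case
      using scale_left[OF hom(1) b, of 0] by (simp add: hom)
  next
    case (step c y z)
    then have "y \<in> homogeneous p" by (auto simp: word_homogeneous)
    then show ?case
      using step right by (auto simp: hom add_left scale_left b)
  qed
  then show ?thesis by (simp add: B_def)
qed


section \<open>Contracting a top-degree form\<close>

text \<open>The Hodge star as iterated contraction of a form \<open>Z\<close>, the first letter being contracted first.\<close>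

definition star :: "('v list \<Rightarrow>\<^sub>0 'f) \<Rightarrow> ('v list \<Rightarrow>\<^sub>0 'f) \<Rightarrow> ('v list \<Rightarrow>\<^sub>0 'f)" where
  "star Z = lin_ext word_scale (\<lambda>us. fold contract us Z)"

lemma linear_star: "Vector_Spaces.linear word_scale word_scale (star Z)"
  unfolding star_def by (rule linear_lin_ext[OF vector_space_word_scale])

lemmas star_simps [simp] = linear_rules[OF linear_star]

lemma star_word [simp]: "star Z (word us) = fold contract us Z"
  by (simp add: star_def vector_space_word_scale)

lemma star_ideal: "a \<in> ext_ideal scale \<Longrightarrow> star Z a = 0"
  unfolding star_def
  by (rule lin_ext_ideal[OF vector_space_word_scale]) (simp_all add: contract_add contract_scale)

lemma star_homogeneous:
  assumes "Z \<in> homogeneous d" "a \<in> homogeneous p"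
  shows "star Z a \<in> homogeneous (d - p)"
  by (rule linear_in_subspace[OF linear_star subspace_homogeneous _ homogeneous_in_span[OF assms(2)]])
    (use fold_contract_homogeneous[OF assms(1)] in auto)

text \<open>Reversing both the rows and the columns multiplies the determinant twice by the sign of the same
  permutation.\<close>

lemma det_gram_rev:
  assumes len: "length us = length ws"
  shows "det (gram g (rev us) (rev ws)) = det (gram g us ws)"
proof -
  define n where "n = length ws"
  define q where "q i = (if i < n then n - 1 - i else i)" for i
  have "bij_betw q {0..<n} {0..<n}"
    by (rule bij_betw_byWitness[where f' = q]) (auto simp: q_def)
  then have q: "q permutes {0..<n}"
    by (rule bij_imp_permutes) (simp add: q_def)
  define A where "A = gram g us ws"
  define B where "B = mat n n (\<lambda>(i, j). A $$ (q i, j))"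
  have A: "A \<in> carrier_mat n n" and B: "B \<in> carrier_mat n n"
    by (auto simp: A_def B_def gram_def n_def len)
  have "det (gram g (rev us) (rev ws)) = det (gram g (rev us) (rev ws))\<^sup>T"
    by (rule det_transpose[symmetric, where n = n]) (auto simp: gram_def n_def len)
  also have "(gram g (rev us) (rev ws))\<^sup>T = mat n n (\<lambda>(i, j). B\<^sup>T $$ (q i, j))"
    by (intro eq_matI) (auto simp: gram_def n_def len A_def B_def q_def rev_nth)
  also have "det \<dots> = signof q * (signof q * det A)"
    using det_permute_rows[OF _ q, of "B\<^sup>T"] det_transpose[OF B] det_permute_rows[OF A q] B
    by (simp add: B_def)
  also have "\<dots> = det A"
    by (simp add: sign_def)
  finally show ?thesis by (simp add: A_def)
qed

text \<open>The identity \<open>r \<and> \<ast>s = g(r, s) Z\<close>. Let \<open>R\<close> be the variant of the star in which the last letter is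
  contracted first. Then \<open>u \<and> R b = R (\<iota>\<^sub>u b)\<close> modulo the relations, without any sign: for
  \<open>b = v \<and> w\<close> the antiderivation rule gives \<open>u \<and> \<iota>\<^sub>v (R w) = g v u (R w) - \<iota>\<^sub>v (u \<and> R w)\<close>,
  whose last term is \<open>\<iota>\<^sub>v (R (\<iota>\<^sub>u w)) = R (v \<and> \<iota>\<^sub>u w)\<close> by induction, and \<open>u \<and> Z = 0\<close> starts the
  induction. Moving all letters of \<open>us\<close> inside contracts the argument of \<open>R\<close> to a scalar, which is
  a determinant. Since \<open>R\<close> and the star differ by reversing words, it is the determinant of a Gram
  matrix with both arguments reversed.\<close>

lemma lwedge_star:
  assumes top: "\<And>u. lwedge [u] Z \<in> ext_ideal scale" and len: "length us = length ws"
  shows "lwedge us (star Z (word ws)) - word_scale (det (gram g us ws)) Z \<in> ext_ideal scale"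
proof -
  note closed = words.subspace_0[OF subspace_ext_ideal] words.subspace_add[OF subspace_ext_ideal]
    words.subspace_diff[OF subspace_ext_ideal] words.subspace_neg[OF subspace_ext_ideal]
  define R where "R = lin_ext word_scale (\<lambda>ws. foldr contract ws Z)"
  have linR: "Vector_Spaces.linear word_scale word_scale R"
    unfolding R_def by (rule linear_lin_ext[OF vector_space_word_scale])
  note R_simps [simp] = linear_rules[OF linR]
  have R_word [simp]: "R (word w) = foldr contract w Z" for w
    by (simp add: R_def vector_space_word_scale)
  have R_lwedge: "R (lwedge [w] b) = contract w (R b)" for w b
    by (rule linear_eq_on_words[where sc = word_scale and F = "\<lambda>b. R (lwedge [w] b)"
          and G = "\<lambda>b. contract w (R b)"])
      (auto intro!: linearI vector_space_word_scale)
  have word_step: "lwedge [u] (R (word w)) - R (contract_word u w) \<in> ext_ideal scale" for u w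
  proof (induction w)
    case Nil
    then show ?case by (simp add: top)
  next
    case (Cons v w)
    have "lwedge [u] (R (word (v # w))) - R (contract_word u (v # w)) =
      - contract v (lwedge [u] (R (word w)) - R (contract_word u w))"
      by (simp add: R_lwedge contract_lwedge g_commute)
    also have "\<dots> \<in> ext_ideal scale"
      by (intro closed contract_ideal Cons)
    finally show ?case .
  qed
  have step: "lwedge [u] (R b) - R (contract u b) \<in> ext_ideal scale" for u b
    by (rule linear_in_subspace[where F = "\<lambda>b. lwedge [u] (R b) - R (contract u b)",
          OF _ subspace_ext_ideal _ in_span_words])
      (use word_step in \<open>auto intro!: linearI vector_space_word_scale simp: words_algebra_simps\<close>)
  have steps: "lwedge us (R b) - R (foldr contract us b) \<in> ext_ideal scale" for b
  proof (induction us)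
    case Nil
    then show ?case by (simp add: closed)
  next
    case (Cons u us)
    have "lwedge (u # us) (R b) - R (foldr contract (u # us) b) =
      lwedge [u] (lwedge us (R b) - R (foldr contract us b)) +
      (lwedge [u] (R (foldr contract us b)) - R (contract u (foldr contract us b)))"
      using lwedge_append[of "[u]" us "R b"] by simp
    also have "\<dots> \<in> ext_ideal scale"
      by (intro closed lwedge_ideal Cons step)
    finally show ?case .
  qed
  have "foldr contract us (word (rev ws)) = word_scale (det (gram g us ws)) (word [])"
  proof -
    have "fold contract (rev us) (word (rev ws)) \<in> homogeneous (length ws - length (rev us))"
      by (rule fold_contract_homogeneous) (simp add: word_homogeneous)
    then have "fold contract (rev us) (word (rev ws)) =
        word_scale (pairing (word (rev us)) (word (rev ws))) (word [])"
      using len homogeneous_0 by (simp add: pairing_word)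
    then show ?thesis
      by (simp add: foldr_conv_fold pairing_words len det_gram_rev)
  qed
  then have "R (foldr contract us (word (rev ws))) = word_scale (det (gram g us ws)) Z"
    by simp
  moreover have "star Z (word ws) = R (word (rev ws))"
    by (simp add: foldr_conv_fold)
  ultimately show ?thesis
    using steps[of "word (rev ws)"] by metis
qed

text \<open>By adjointness \<open>g(\<ast>s, \<ast>r) = g(r \<and> \<ast>s, Z)\<close>, and \<open>r \<and> \<ast>s\<close> is a multiple of \<open>Z\<close>.\<close>

lemma pairing_star:
  assumes top: "\<And>u. lwedge [u] Z \<in> ext_ideal scale"
    and a: "a \<in> homogeneous p" and b: "b \<in> homogeneous p"
  shows "pairing (star Z a) (star Z b) =
    pairing a b * pairing Z Z"
proof -
  have words: "pairing (star Z (word ws)) (star Z (word us)) = pairing (word ws) (word us) * pairing Z Z"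
    if len: "length ws = p" "length us = p" for us ws
  proof -
    have "pairing (star Z (word ws)) (star Z (word us)) = pairing (lwedge us (star Z (word ws))) Z"
      by (simp add: pairing_lwedge)
    also have "\<dots> = det (gram g us ws) * pairing Z Z"
      using pairing_ideal_left[OF lwedge_star[of Z us ws], of Z] len by (simp add: top)
    also have "det (gram g us ws) = det (gram g us ws)\<^sup>T"
      by (rule det_transpose[symmetric, where n = p]) (simp add: gram_def len)
    also have "(gram g us ws)\<^sup>T = gram g ws us"
      by (rule eq_matI) (auto simp: gram_def g_commute)
    finally show ?thesis by (simp add: pairing_words len)
  qed
  have "pairing (star Z (word ws)) (star Z b) = pairing (word ws) b * pairing Z Z"
    if "length ws = p" for ws
    by (rule linear_eq_on_words[where sc = "(*)" and F = "\<lambda>b. pairing (star Z (word ws)) (star Z b)"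
        and G = "\<lambda>b. pairing (word ws) b * pairing Z Z"])
      (use words that b in \<open>auto intro!: linearI vector_space_word_scale vector_space_field
        simp: homogeneous_def algebra_simps\<close>)
  then show ?thesis
    by - (rule linear_eq_on_words[where sc = "(*)" and F = "\<lambda>a. pairing (star Z a) (star Z b)"
        and G = "\<lambda>a. pairing a b * pairing Z Z"];
      use a in \<open>auto intro!: linearI vector_space_word_scale vector_space_field
        simp: homogeneous_def algebra_simps\<close>)
qed


section \<open>Words with repeated letters\<close>

text \<open>Polarisation of the relation \<open>(a + b) \<and> (a + b) = 0\<close>.\<close>

lemma word_swap_ideal: "word (a # b # us) + word (b # a # us) \<in> ext_ideal scale"
proof -
  have "word (a # b # us) + word (b # a # us) =
     word ((a + b) # (a + b) # us) - word (a # a # us) - word (b # b # us)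
     - (word ((a + b) # (a + b) # us) - word (a # (a + b) # us) - word (b # (a + b) # us))
     - (word (a # (a + b) # us) - word (a # a # us) - word (a # b # us))
     - (word (b # (a + b) # us) - word (b # a # us) - word (b # b # us))"
    by simp
  also have "\<dots> \<in> ext_ideal scale"
    using ext_ideal_square[of "[]" "a + b" us] ext_ideal_square[of "[]" a us]
      ext_ideal_square[of "[]" b us] ext_ideal_add[of "[]" a b "(a + b) # us"]
      ext_ideal_add[of "[a]" a b us] ext_ideal_add[of "[b]" a b us]
    unfolding lwedge_simps lwedge_word append_Nil append_Cons
    by - (assumption | rule words.subspace_diff[OF subspace_ext_ideal])+
  finally show ?thesis .
qed

lemma word_repeat_ideal: "a \<in> set us \<Longrightarrow> word (a # us) \<in> ext_ideal scale"
proof (induction us)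
  case (Cons b us)
  show ?case
  proof (cases "a = b")
    case True
    then show ?thesis using ext_ideal_square[of "[]" a us] by simp
  next
    case False
    then have "lwedge [b] (word (a # us)) \<in> ext_ideal scale"
      using Cons by (intro lwedge_ideal) auto
    then show ?thesis
      using words.subspace_diff[OF subspace_ext_ideal word_swap_ideal[of a b us]] by fastforce
  qed
qed simp

end


section \<open>The reciprocal basis and its top-degree form\<close>

locale based_scalar_product_space = scalar_product_space scale g
  for scale :: "'f::field \<Rightarrow> 'v::ab_group_add \<Rightarrow> 'v" and g +
  fixes d :: nat and x :: "nat \<Rightarrow> 'v"
  assumes basis: "is_indexed_basis scale d x"
begin

lemma span_basis: "v \<in> span (x ` {..<d})"
  using basis by (simp add: is_indexed_basis_def)

lemma g_eqI:
  assumes "\<And>j. j < d \<Longrightarrow> g v (x j) = g w (x j)"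
  shows "v = w"
proof -
  have "g v y = g w y" for y
    using span_basis[of y]
    by (induction rule: span_induct) (use assms in \<open>auto simp: subspace_def\<close>)
  then have "g (v - w) y = 0" for y
    using g_simps(1)[of "v - w" w y] by simp
  then show ?thesis
    using g_nondegenerate[of "v - w"] by simp
qed

text \<open>The map \<open>v \<mapsto> \<Sum>\<^sub>j g v x\<^sub>j \<cdot> x\<^sub>j\<close> is injective by nondegeneracy, hence surjective in finite
  dimension; a preimage of \<open>x\<^sub>i\<close> is the reciprocal vector.\<close>

lemma exists_reciprocal:
  assumes "i < d"
  shows "\<exists>v. \<forall>j<d. g v (x j) = (if i = j then 1 else 0)"
proof -
  interpret fd: finite_dimensional_vector_space scale "x ` {..<d}"
    by unfold_locales (use basis in \<open>auto simp: is_indexed_basis_def\<close>)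
  have inj: "inj_on x {..<d}"
    using basis by (simp add: is_indexed_basis_def)
  define \<Phi> where "\<Phi> v = (\<Sum>j<d. scale (g v (x j)) (x j))" for v
  have coeff: "c j = c' j"
    if "(\<Sum>j<d. scale (c j) (x j)) = (\<Sum>j<d. scale (c' j) (x j))" "j < d" for c c' j
  proof -
    define u where "u y = (let j = the_inv_into {..<d} x y in c j - c' j)" for y
    have u: "u (x j) = c j - c' j" if "j < d" for j
      using that inj by (simp add: u_def the_inv_into_f_f)
    have "(\<Sum>y\<in>x ` {..<d}. scale (u y) y) = (\<Sum>j<d. scale (c j - c' j) (x j))"
      using inj by (simp add: sum.reindex u)
    also have "\<dots> = 0"
      using that by (simp add: scale_left_diff_distrib sum_subtractf)
    finally have "u (x j) = 0"
      using independentD[OF fd.independent_Basis, of "x ` {..<d}" u] \<open>j < d\<close> by auto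
    then show ?thesis using u \<open>j < d\<close> by simp
  qed
  have "Vector_Spaces.linear scale scale \<Phi>"
    by (rule linearI) (simp_all add: vector_space_axioms \<Phi>_def scale_left_distrib sum.distrib scale_sum_right)
  moreover have "inj \<Phi>"
  proof (rule injI)
    fix v w assume "\<Phi> v = \<Phi> w"
    then show "v = w"
      unfolding \<Phi>_def by (intro g_eqI) (rule coeff)
  qed
  ultimately obtain v where "\<Phi> v = x i"
    using fd.linear_inj_imp_surj by (metis surjD)
  also have "x i = (\<Sum>j<d. scale (if i = j then 1 else 0) (x j))"
  proof -
    have "(\<Sum>j<d. scale (if i = j then 1 else 0) (x j)) = (\<Sum>j<d. if i = j then x j else 0)"
      by (intro sum.cong) auto
    then show ?thesis using assms by simp
  qed
  finally show ?thesis
    unfolding \<Phi>_def using coeff[of "\<lambda>j. g v (x j)" "\<lambda>j. if i = j then 1 else 0"]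
    by (intro exI[of _ v]) blast
qed

lemma g_reciprocal:
  assumes "i < d" "j < d"
  shows "g (reciprocal g d x i) (x j) = (if i = j then 1 else 0)"
proof -
  have "\<exists>!v. \<forall>j<d. g v (x j) = (if i = j then 1 else 0)"
    using exists_reciprocal[OF assms(1)] by (elim ex_ex1I) (rule g_eqI, simp)
  from theI'[OF this] show ?thesis
    using assms(2) by (auto simp: reciprocal_def)
qed

text \<open>Keeping track of the length makes this serve two purposes: it yields the vanishing of words longer
  than \<open>d\<close> and the uniqueness of the Hodge star.\<close>

lemma word_in_span:
  "word w \<in> words.span (ext_ideal scale \<union>
     {word (map x js) | js. distinct js \<and> set js \<subseteq> {..<d} \<and> length js = length w})"
proof (induction w)
  case Nil
  show ?case by (rule words.span_base) auto
next
  case (Cons v w)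
  define T where "T = words.span (ext_ideal scale \<union>
     {word (map x js) | js. distinct js \<and> set js \<subseteq> {..<d} \<and> length js = length (v # w)})"
  have ideal_T: "a \<in> T" if "a \<in> ext_ideal scale" for a
    using that by (auto simp: T_def intro: words.span_base)
  have T: "words.subspace T" by (simp add: T_def)
  have cons: "word (v # map x js) \<in> T"
    if js: "distinct js" "set js \<subseteq> {..<d}" "length js = length w" for js
    using span_basis[of v]
  proof (induction rule: span_induct_alt)
    case base
    have "word (scale 0 0 # map x js) - word_scale 0 (word (0 # map x js)) \<in> ext_ideal scale"
      using ext_ideal_scale[of "[]"] by (simp only: lwedge_Nil)
    then show ?case by (simp add: ideal_T)
  next
    case (step c y z)
    then obtain i where i: "y = x i" "i < d" by auto
    have y: "word (y # map x js) \<in> T"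
    proof (cases "i \<in> set js")
      case True
      then show ?thesis by (simp add: i ideal_T word_repeat_ideal)
    next
      case False
      then have "word (map x (i # js)) \<in> T"
        unfolding T_def by (intro words.span_base) (use js i in \<open>auto intro!: exI[of _ "i # js"]\<close>)
      then show ?thesis by (simp add: i)
    qed
    have "word ((scale c y + z) # map x js) - word (scale c y # map x js) - word (z # map x js) \<in> T"
      using ext_ideal_add[of "[]"] by (intro ideal_T) (simp only: lwedge_Nil)
    moreover have "word (scale c y # map x js) - word_scale c (word (y # map x js)) \<in> T"
      using ext_ideal_scale[of "[]"] by (intro ideal_T) (simp only: lwedge_Nil)
    ultimately have "(word ((scale c y + z) # map x js) - word (scale c y # map x js) - word (z # map x js))
      + (word (scale c y # map x js) - word_scale c (word (y # map x js)))
      + word_scale c (word (y # map x js)) + word (z # map x js) \<in> T"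
      by (intro words.subspace_add[OF T] words.subspace_scale[OF T] y step)
    then show ?case by simp
  qed
  have "lwedge [v] (word w) \<in> T"
    by (rule linear_in_subspace[OF linear_lwedge T _ Cons])
      (auto intro: ideal_T lwedge_ideal cons)
  then show ?case by (simp add: T_def)
qed

lemma long_word_ideal:
  assumes "d < length w"
  shows "word w \<in> ext_ideal scale"
proof -
  have "length js \<noteq> length w" if "distinct js" "set js \<subseteq> {..<d}" for js
    using assms that card_mono[OF _ that(2)] by (auto simp: distinct_card)
  then have "{word (map x js) | js. distinct js \<and> set js \<subseteq> {..<d} \<and> length js = length w} =
      ({} :: ('v list \<Rightarrow>\<^sub>0 'f) set)"
    by blast
  then have "word w \<in> words.span (ext_ideal scale)"
    using word_in_span[of w] by (simp only: Un_empty_right)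
  then show ?thesis
    using words.span_minimal[OF order.refl subspace_ext_ideal] by blast
qed

text \<open>The word of the reciprocal basis in the order \<open>\<rho>\<close>; \<open>top_form id\<close> is the form \<open>Z\<close> that defines
  the Hodge star.\<close>

definition top_form :: "(nat \<Rightarrow> nat) \<Rightarrow> ('v list \<Rightarrow>\<^sub>0 'f)" where
  "top_form \<rho> = word (map (\<lambda>k. reciprocal g d x (\<rho> k)) [0..<d])"

lemma top_form_homogeneous: "top_form \<rho> \<in> homogeneous d"
  by (simp add: top_form_def word_homogeneous)

lemma lwedge_top_form: "lwedge [u] (top_form \<rho>) \<in> ext_ideal scale"
  by (simp add: top_form_def long_word_ideal)

lemma contract_word_orthogonal: "(\<And>u. u \<in> set us \<Longrightarrow> g v u = 0) \<Longrightarrow> contract_word v us = 0"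
  by (induction us) auto

lemma contract_top_form:
  assumes \<rho>: "\<rho> permutes {..<d}" and n: "n \<le> d"
  shows "fold contract (map (\<lambda>k. x (\<rho> k)) [0..<n]) (top_form \<rho>) =
    word (map (\<lambda>k. reciprocal g d x (\<rho> k)) [n..<d])"
  using n
proof (induction n)
  case 0
  then show ?case by (simp add: top_form_def)
next
  case (Suc n)
  have lt: "\<rho> k < d" if "k < d" for k
    using permutes_in_image[OF \<rho>, of k] that by simp
  have g: "g (x (\<rho> n)) (reciprocal g d x (\<rho> k)) = (if k = n then 1 else 0)" if "k < d" for k
    using that Suc.prems permutes_inj[OF \<rho>]
    by (auto simp: g_commute[of "x _"] g_reciprocal lt inj_eq)
  have "contract_word (x (\<rho> n)) (map (\<lambda>k. reciprocal g d x (\<rho> k)) [Suc n..<d]) = 0"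
    by (rule contract_word_orthogonal) (auto simp: g)
  then show ?case
    using Suc by (simp add: upt_conv_Cons[of n d] g)
qed

lemma det_gram_reciprocal:
  assumes \<rho>: "\<rho> permutes {..<d}"
  shows "det (gram g (map (reciprocal g d x) [0..<d]) (map (\<lambda>k. x (\<rho> k)) [0..<d])) = of_int (sign \<rho>)"
proof -
  have lt: "\<rho> k < d" if "k < d" for k
    using permutes_in_image[OF \<rho>, of k] that by simp
  let ?A = "gram g (map (reciprocal g d x) [0..<d]) (map (\<lambda>k. x (\<rho> k)) [0..<d])"
  have "det ?A = det ?A\<^sup>T"
    by (rule det_transpose[symmetric, where n = d]) (simp add: gram_def)
  also have "?A\<^sup>T = mat d d (\<lambda>(i, j). 1\<^sub>m d $$ (\<rho> i, j))"
    by (rule eq_matI) (auto simp: gram_def g_reciprocal lt)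
  also have "det \<dots> = of_int (sign \<rho>)"
    using det_permute_rows[of "1\<^sub>m d" d \<rho>] \<rho> by (simp add: atLeast0LessThan)
  finally show ?thesis .
qed

text \<open>The sign under reordering comes from \<open>lwedge_star\<close> applied to the reordered form: its contraction
  with \<open>x\<^bsub>\<rho> 0\<^esub>, x\<^bsub>\<rho> 1\<^esub>, \<dots>\<close> is \<open>1\<close>, and the Gram matrix involved is a permutation matrix.\<close>

lemma top_form_permute:
  assumes \<rho>: "\<rho> permutes {..<d}"
  shows "top_form id - word_scale (of_int (sign \<rho>)) (top_form \<rho>) \<in> ext_ideal scale"
  using lwedge_star[of "top_form \<rho>" "map (reciprocal g d x) [0..<d]" "map (\<lambda>k. x (\<rho> k)) [0..<d]"]
    contract_top_form[OF \<rho> order.refl]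
  by (simp add: lwedge_top_form det_gram_reciprocal[OF \<rho>]) (simp add: top_form_def)

text \<open>By \<open>lwedge_star\<close> the word \<open>x\<^sub>0 \<dots> x\<^bsub>d-1\<^esub>\<close> is \<open>G\<close> times the reciprocal form, while contracting
  the reciprocal form with that word gives \<open>1\<close>.\<close>

lemma top_form_norm:
  "det (mat d d (\<lambda>(i, j). g (x i) (x j))) * pairing (top_form id) (top_form id) = 1"
proof -
  let ?xs = "map x [0..<d]" and ?G = "det (mat d d (\<lambda>(i, j). g (x i) (x j)))"
  have "gram g ?xs ?xs = mat d d (\<lambda>(i, j). g (x i) (x j))"
    by (rule eq_matI) (auto simp: gram_def)
  then have "word ?xs - word_scale ?G (top_form id) \<in> ext_ideal scale"
    using lwedge_star[of "top_form id" ?xs ?xs] contract_top_form[OF permutes_id order.refl]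
    by (simp add: lwedge_top_form)
  from pairing_ideal_left[OF this, of "top_form id"]
  have "?G * pairing (top_form id) (top_form id) = pairing (word ?xs) (top_form id)"
    by simp
  also have "\<dots> = 1"
    using contract_top_form[OF permutes_id order.refl] by (simp add: pairing_word)
  finally show ?thesis .
qed


section \<open>Existence and uniqueness of the Hodge star\<close>

text \<open>\<open>star\<close> annihilates the ideal, so the chosen representative does not matter.\<close>

definition hodge_rep :: "('f, 'v) multivector \<Rightarrow> ('f, 'v) multivector" where
  "hodge_rep r = ext_coset scale (star (top_form id) (SOME a. ext_coset scale a = r))"

lemma hodge_rep_coset: "hodge_rep (ext_coset scale a) = ext_coset scale (star (top_form id) a)"
proof -
  have "ext_coset scale (SOME b. ext_coset scale b = ext_coset scale a) = ext_coset scale a"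
    by (rule someI) (rule refl)
  then have "star (top_form id) ((SOME b. ext_coset scale b = ext_coset scale a) - a) = 0"
    by (intro star_ideal) (simp add: coset_eq_iff)
  then show ?thesis
    unfolding hodge_rep_def star_simps by simp
qed

lemma is_hodge_star_rep: "is_hodge_star scale g d x hodge_rep"
  unfolding is_hodge_star_def
proof (intro conjI ballI allI impI)
  fix n and \<rho> :: "nat \<Rightarrow> nat" assume "n \<le> d \<and> \<rho> permutes {..<d}"
  then have n: "n \<le> d" and \<rho>: "\<rho> permutes {..<d}" by auto
  have "fold contract (map (\<lambda>k. x (\<rho> k)) [0..<n])
      (top_form id - word_scale (of_int (sign \<rho>)) (top_form \<rho>)) \<in> ext_ideal scale"
    by (rule fold_contract_ideal[OF top_form_permute[OF \<rho>]])
  then show "hodge_rep (wedge scale (map (\<lambda>k. x (\<rho> k)) [0..<n])) =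
      ext_scale scale (of_int (sign \<rho>)) (wedge scale (map (\<lambda>k. reciprocal g d x (\<rho> k)) [n..<d]))"
    by (simp add: wedge_def hodge_rep_coset ext_scale_coset coset_eq_iff contract_top_form[OF \<rho> n])
qed (auto simp: ext_algebra_def hodge_rep_coset ext_add_coset ext_scale_coset)

lemma exists_permutation_of_indices:
  assumes js: "distinct js" "set js \<subseteq> {..<d}"
  obtains \<rho> where "\<rho> permutes {..<d}" "map \<rho> [0..<length js] = js" "length js \<le> d"
proof -
  have len: "length js \<le> d"
    using card_mono[OF _ js(2)] distinct_card[OF js(1)] by simp
  have "card {length js..<d} = card ({..<d} - set js)"
    using js by (simp add: card_Diff_subset distinct_card)
  then obtain f where f: "bij_betw f {length js..<d} ({..<d} - set js)"
    using finite_same_card_bij[of "{length js..<d}" "{..<d} - set js"] by auto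
  define \<rho> where "\<rho> k = (if k < length js then js ! k else if k < d then f k else k)" for k
  have "bij_betw \<rho> {..<length js} (set js)"
    using bij_betw_nth[OF js(1) refl refl] by (rule bij_betw_cong[THEN iffD1, rotated]) (simp add: \<rho>_def)
  moreover have "bij_betw \<rho> {length js..<d} ({..<d} - set js)"
    using f by (rule bij_betw_cong[THEN iffD1, rotated]) (simp add: \<rho>_def)
  ultimately have "bij_betw \<rho> ({..<length js} \<union> {length js..<d}) (set js \<union> ({..<d} - set js))"
    by (rule bij_betw_combine) auto
  moreover have "{..<length js} \<union> {length js..<d} = {..<d}" "set js \<union> ({..<d} - set js) = {..<d}"
    using len js(2) by auto
  ultimately have "\<rho> permutes {..<d}"
    by (intro bij_imp_permutes) (auto simp: \<rho>_def dest: leD len[THEN order.trans, rotated])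
  moreover have "map \<rho> [0..<length js] = js"
    by (rule nth_equalityI) (auto simp: \<rho>_def)
  ultimately show thesis using that len by blast
qed

text \<open>The specification prescribes the values on all products of distinct basis vectors, because every
  list of distinct indices extends to a permutation.\<close>

lemma hodge_star_unique:
  assumes h: "is_hodge_star scale g d x h"
  shows "h (ext_coset scale a) = ext_coset scale (star (top_form id) a)"
proof -
  let ?P = "\<lambda>a. h (ext_coset scale a) = ext_coset scale (star (top_form id) a)"
  have range: "ext_coset scale a \<in> ext_algebra scale" for a
    by (simp add: ext_algebra_def)
  have h_add: "h (ext_coset scale (a + b)) = ext_add (h (ext_coset scale a)) (h (ext_coset scale b))" for a b
    using h range by (simp add: is_hodge_star_def flip: ext_add_coset)
  have h_scale: "h (ext_coset scale (word_scale c a)) = ext_scale scale c (h (ext_coset scale a))" for c a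
    using h range by (simp add: is_hodge_star_def flip: ext_scale_coset)
  have zero: "?P 0"
  proof -
    obtain b where "h (ext_coset scale 0) = ext_coset scale b"
      using h range[of 0] unfolding is_hodge_star_def ext_algebra_def by blast
    then show ?thesis
      using h_scale[of 0 0] by (simp add: ext_scale_coset)
  qed
  have sub: "words.subspace (Collect ?P)"
    using zero by (auto simp: words.subspace_def h_add h_scale ext_add_coset ext_scale_coset)
  have words: "?P (word w)" for w
    using word_in_span[of w]
  proof (rule words.span_induct[OF _ sub], elim UnE)
    fix b :: "'v list \<Rightarrow>\<^sub>0 'f" assume b: "b \<in> ext_ideal scale"
    then have "ext_coset scale b = ext_coset scale 0"
      by (simp add: coset_eq_iff)
    then show "?P b"
      using zero by (simp add: star_ideal[OF b])
  next
    fix b :: "'v list \<Rightarrow>\<^sub>0 'f" assume "b \<in> {word (map x js) | js. distinct js \<and> set js \<subseteq> {..<d} \<and> length js = length w}"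
    then obtain js where js: "distinct js" "set js \<subseteq> {..<d}" and b: "b = word (map x js)"
      by auto
    obtain \<rho> where \<rho>: "\<rho> permutes {..<d}" "map \<rho> [0..<length js] = js" "length js \<le> d"
      using exists_permutation_of_indices[OF js] .
    have wedge_b: "ext_coset scale b = wedge scale (map (\<lambda>k. x (\<rho> k)) [0..<length js])"
      using arg_cong[OF \<rho>(2), of "map x"] by (simp add: b wedge_def comp_def)
    have "h (ext_coset scale b) = hodge_rep (ext_coset scale b)"
      unfolding wedge_b using h is_hodge_star_rep \<rho>(1,3) unfolding is_hodge_star_def by presburger
    then show "?P b" by (simp add: hodge_rep_coset)
  qed
  show ?thesis
    by (rule words.span_induct[OF in_span_words sub]) (use words in auto)
qed

lemma hodge_star_coset:
  "hodge_star scale g d x (ext_coset scale a) = ext_coset scale (star (top_form id) a)"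
  unfolding hodge_star_def by (rule hodge_star_unique)
    (rule someI[where P = "is_hodge_star scale g d x"], rule is_hodge_star_rep)

end


section \<open>The scalar product of Hodge duals\<close>

theorem mainTheorem5:
  fixes scale :: "'f::field \<Rightarrow> 'v::ab_group_add \<Rightarrow> 'v"
    and Basis :: "'v set"
    and g :: "'v \<Rightarrow> 'v \<Rightarrow> 'f"
    and d p :: nat
    and x :: "nat \<Rightarrow> 'v"
    and r s :: "('f, 'v) multivector"
    and G :: 'f
  assumes "finite_dimensional_vector_space scale Basis"
    and "vector_space.dim scale (UNIV :: 'v set) = d"
    and "scalar_product scale g"
    and "is_indexed_basis scale d x"
    and "r \<in> ext_power scale p"
    and "s \<in> ext_power scale p"
    and "G = det (mat d d (\<lambda>(i, j). g (x i) (x j)))"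
  shows "ext_scalar_product scale g r s =
    G * ext_scalar_product scale g (hodge_star scale g d x r) (hodge_star scale g d x s)"
proof -
  interpret finite_dimensional_vector_space scale Basis by fact
  interpret based_scalar_product_space scale g d x
    by unfold_locales fact+
  obtain a b where a: "a \<in> homogeneous p" "r = ext_coset scale a"
    and b: "b \<in> homogeneous p" "s = ext_coset scale b"
    using assms(5,6) by (auto simp: ext_power_def homogeneous_def)
  let ?Z = "top_form id"
  have "ext_scalar_product scale g (hodge_star scale g d x r) (hodge_star scale g d x s) =
      pairing (star ?Z a) (star ?Z b)"
    unfolding a(2) b(2) hodge_star_coset
    by (rule ext_scalar_product_coset) (rule star_homogeneous[OF top_form_homogeneous] a b)+
  also have "\<dots> = pairing a b * pairing ?Z ?Z"
    by (rule pairing_star[OF lwedge_top_form a(1) b(1)])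
  finally have "G * ext_scalar_product scale g (hodge_star scale g d x r) (hodge_star scale g d x s) =
      pairing a b * (G * pairing ?Z ?Z)"
    by simp
  also have "\<dots> = pairing a b"
    by (simp add: assms(7) top_form_norm)
  also have "\<dots> = ext_scalar_product scale g r s"
    unfolding a(2) b(2) using a(1) b(1) by (rule ext_scalar_product_coset[symmetric])
  finally show ?thesis ..
qed

end
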